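(* Let $R$ be a finite commutative ring with identity which is not a field. Then $$\gamma^o(\Gamma(R))+2 \leq |Z(R)|.$$ Moreover, this bound is sharp: equality holds for $R=\mathbb{Z}_9$.
   Context: $Z(R)$ denotes the set of zero-divisors of $R$, including $0$, and $Z(R)^*=Z(R)\setminus\{0\}$. The zero-divisor graph $\Gamma(R)$ is the simple graph with vertex set $Z(R)^*$, in which distinct $u,v$ are adjacent if and only if $uv=0$. For a simple graph $\Gamma=(V,E)$, a set $S\subseteq V$ and a vertex $v$, let $N(v)$ be the set of neighbors of $v$, $\delta_S(v)=|N(v)\cap S|$ and $\overline{S}=V\setminus S$. A nonempty set $S\subseteq V$ is a global offensive alliance if $\delta_S(v)\geq \delta_{\overline{S}}(v)+1$ for every $v\in\overline{S}$. The global offensive alliance number $\gamma^o(\Gamma)$ is the minimum cardinality of a global offensive alliance of $\Gamma$.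
   Formalization: The bound is proved under the extra assumptions 1 ≠ 0 and |Z(R)| ≠ 2: when |Z(R)| = 2 (for example R = Z_4) the graph is a single vertex, γ^o = 1 and the bound fails; for the zero ring γ^o is undefined. *)

theory Defs
  imports "HOL-Number_Theory.Residues" "Graph_Theory.Pair_Digraph"
begin

text \<open>
  In a ring with \<open>\<one> \<noteq> \<zero>\<close> the element \<open>\<zero>\<close> satisfies this condition, so it is counted as a
  zero-divisor.
\<close>
definition zero_divisors :: "('a, 'm) ring_scheme \<Rightarrow> 'a set" where
  "zero_divisors R =
     {x \<in> carrier R. \<exists>y \<in> carrier R. y \<noteq> \<zero>\<^bsub>R\<^esub> \<and> x \<otimes>\<^bsub>R\<^esub> y = \<zero>\<^bsub>R\<^esub>}"

text \<open>A simple graph is a symmetric loop-free digraph: an edge is a pair of opposite arcs.\<close>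
definition zero_divisor_graph :: "('a, 'm) ring_scheme \<Rightarrow> 'a pair_pre_digraph" where
  "zero_divisor_graph R =
     \<lparr> pverts = zero_divisors R - {\<zero>\<^bsub>R\<^esub>},
       parcs = {(u, v). u \<in> zero_divisors R - {\<zero>\<^bsub>R\<^esub>} \<and> v \<in> zero_divisors R - {\<zero>\<^bsub>R\<^esub>} \<and>
                        u \<noteq> v \<and> u \<otimes>\<^bsub>R\<^esub> v = \<zero>\<^bsub>R\<^esub>} \<rparr>"

definition neighbors :: "'a pair_pre_digraph \<Rightarrow> 'a \<Rightarrow> 'a set" where
  "neighbors G v = {w. (v, w) \<in> parcs G}"

definition degree_in :: "'a pair_pre_digraph \<Rightarrow> 'a set \<Rightarrow> 'a \<Rightarrow> nat" where
  "degree_in G S v = card (neighbors G v \<inter> S)"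

definition global_offensive_alliance :: "'a pair_pre_digraph \<Rightarrow> 'a set \<Rightarrow> bool" where
  "global_offensive_alliance G S \<longleftrightarrow>
     S \<noteq> {} \<and> S \<subseteq> pverts G \<and>
     (\<forall>v \<in> pverts G - S. degree_in G S v \<ge> degree_in G (pverts G - S) v + 1)"

text \<open>Meaningful for graphs with a finite nonempty vertex set, which is itself an alliance.\<close>
definition global_offensive_alliance_number :: "'a pair_pre_digraph \<Rightarrow> nat" where
  "global_offensive_alliance_number G = Min {card S | S. global_offensive_alliance G S}"

lemma (in ring) zero_in_zero_divisors:
  "\<one> \<noteq> \<zero> \<Longrightarrow> \<zero> \<in> zero_divisors R"
  by (auto simp: zero_divisors_def intro!: bexI[of _ \<one>])

lemma pair_graph_zero_divisor_graph:
  assumes "cring R" and "finite (carrier R)"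
  shows "pair_graph (zero_divisor_graph R)"
proof -
  interpret cring R by fact
  have fin: "finite (zero_divisors R)"
    using assms(2) by (simp add: zero_divisors_def)
  have "parcs (zero_divisor_graph R) \<subseteq> zero_divisors R \<times> zero_divisors R"
    by (auto simp: zero_divisor_graph_def)
  then have "finite (parcs (zero_divisor_graph R))"
    using fin by (meson finite_SigmaI finite_subset)
  moreover have "sym (parcs (zero_divisor_graph R))"
    by (auto simp: zero_divisor_graph_def zero_divisors_def sym_def m_comm)
  ultimately show ?thesis
    using fin by unfold_locales (auto simp: zero_divisor_graph_def symmetric_def)
qed

text \<open>
  If there is exactly one nonzero zero-divisor, the graph is a single vertex and the bound
  \<open>\<gamma>\<^sup>o + 2 \<le> card Z\<close> fails; this happens for the integers modulo 4.
\<close>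
lemma alliance_number_two_zero_divisors:
  assumes "ring R" and "\<one>\<^bsub>R\<^esub> \<noteq> \<zero>\<^bsub>R\<^esub>" and "card (zero_divisors R) = 2"
  shows "global_offensive_alliance_number (zero_divisor_graph R) = 1"
proof -
  have "\<zero>\<^bsub>R\<^esub> \<in> zero_divisors R"
    using ring.zero_in_zero_divisors[OF assms(1,2)] .
  then have "card (zero_divisors R - {\<zero>\<^bsub>R\<^esub>}) = 1"
    using assms(3) by (simp add: card_Diff_singleton)
  then obtain a where "zero_divisors R - {\<zero>\<^bsub>R\<^esub>} = {a}"
    by (auto simp: card_1_singleton_iff)
  then have V: "pverts (zero_divisor_graph R) = {a}"
    by (simp add: zero_divisor_graph_def)
  have "global_offensive_alliance (zero_divisor_graph R) S \<longleftrightarrow> S = {a}" for S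
    unfolding global_offensive_alliance_def V by auto
  then show ?thesis
    by (simp add: global_offensive_alliance_number_def)
qed

lemma zero_divisors_residue_ring_4: "zero_divisors (residue_ring 4) = {0, 2}"
proof -
  have c: "carrier (residue_ring 4) = {0, 1, 2, 3}"
    by (auto simp: residue_ring_def)
  show ?thesis
    unfolding zero_divisors_def c by (auto simp: residue_ring_def)
qed

lemma bound_fails_residue_ring_4:
  "\<not> global_offensive_alliance_number (zero_divisor_graph (residue_ring 4)) + 2
       \<le> card (zero_divisors (residue_ring 4))"
proof -
  interpret residues 4 "residue_ring 4" by unfold_locales simp_all
  have "global_offensive_alliance_number (zero_divisor_graph (residue_ring 4)) = 1"
    by (rule alliance_number_two_zero_divisors[OF ring_axioms])
       (simp_all add: zero_divisors_residue_ring_4 one_cong res_one_eq res_zero_eq)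
  then show ?thesis
    by (simp add: zero_divisors_residue_ring_4)
qed

end

theory Submission
  imports Defs
begin

text \<open>
  Removing one vertex that has a neighbour from the vertex set leaves a global offensive
  alliance, so it suffices that \<open>\<Gamma>(R)\<close> has an edge. Take distinct vertices \<open>v\<close> and \<open>w\<close>. If neither
  is annihilated by a nonzero element other than itself, then \<open>v\<^sup>2 = w\<^sup>2 = 0\<close>; now either \<open>v w = 0\<close>,
  or \<open>v w\<close> is a neighbour of \<open>v\<close>, because \<open>v w = v\<close> would give \<open>v = v w\<^sup>2 = 0\<close>.
\<close>

lemma pverts_zero_divisor_graph [simp]:
  "pverts (zero_divisor_graph R) = zero_divisors R - {\<zero>\<^bsub>R\<^esub>}"
  by (simp add: zero_divisor_graph_def)

text \<open>Cancellation makes multiplication by a nonzero element injective, hence surjective on a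
  finite carrier, so \<open>\<one>\<close> is reached. Used contrapositively: a finite ring that is
  not a field yields a vertex.\<close>

lemma (in cring) finite_no_zero_divisors_field:
  assumes fin: "finite (carrier R)" and "\<one> \<noteq> \<zero>" and Z: "zero_divisors R \<subseteq> {\<zero>}"
  shows "field R"
proof -
  have integral: "a \<otimes> b = \<zero> \<Longrightarrow> a \<in> carrier R \<Longrightarrow> b \<in> carrier R \<Longrightarrow> a = \<zero> \<or> b = \<zero>" for a b
    using Z by (auto simp: zero_divisors_def)
  interpret domain R
    using \<open>\<one> \<noteq> \<zero>\<close> integral by unfold_locales auto
  show ?thesis
  proof (rule cring_fieldI2)
    show "\<zero> \<noteq> \<one>"
      using \<open>\<one> \<noteq> \<zero>\<close> by simp
    fix a assume a: "a \<in> carrier R" "a \<noteq> \<zero>"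
    have "inj_on ((\<otimes>) a) (carrier R)"
      using a by (auto intro: inj_onI simp: m_lcancel)
    moreover have "(\<otimes>) a ` carrier R \<subseteq> carrier R"
      using a by auto
    ultimately have "(\<otimes>) a ` carrier R = carrier R"
      using fin by (simp add: endo_inj_surj)
    then show "\<exists>b\<in>carrier R. a \<otimes> b = \<one>"
      by (metis imageE one_closed)
  qed
qed

lemma (in cring) zero_divisor_graph_has_arc:
  assumes v: "v \<in> zero_divisors R - {\<zero>}" and w: "w \<in> zero_divisors R - {\<zero>}" and "v \<noteq> w"
  obtains x y where "(x, y) \<in> parcs (zero_divisor_graph R)"
proof (rule ccontr)
  assume "\<not> thesis"
  with that have no_arc: "(x, y) \<notin> parcs (zero_divisor_graph R)" for x y
    by blast
  \<comment> \<open>Nonzero elements with product zero witness each other as zero-divisors, so both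
    are vertices; if distinct, they would form an arc.\<close>
  have annihilated: "x = y"
    if "x \<in> carrier R" "y \<in> carrier R" "x \<noteq> \<zero>" "y \<noteq> \<zero>" "x \<otimes> y = \<zero>" for x y
    using no_arc[of x y] that m_comm[of x y]
    by (auto simp: zero_divisor_graph_def zero_divisors_def)
  have c: "v \<in> carrier R" "w \<in> carrier R" "v \<noteq> \<zero>" "w \<noteq> \<zero>"
    using v w by (auto simp: zero_divisors_def)
  \<comment> \<open>The nonzero annihilator that makes \<open>v\<close> a zero-divisor can only be
    \<open>v\<close> itself; likewise for \<open>w\<close>.\<close>
  have vv: "v \<otimes> v = \<zero>" and ww: "w \<otimes> w = \<zero>"
    using v w annihilated by (auto simp: zero_divisors_def)
  have "v \<otimes> w \<noteq> \<zero>"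
    using annihilated c \<open>v \<noteq> w\<close> by blast
  moreover have "v \<otimes> (v \<otimes> w) = \<zero>"
    using c vv by (simp flip: m_assoc)
  ultimately have "v = v \<otimes> w"
    using annihilated c by blast
  \<comment> \<open>Substitute \<open>v = v \<otimes> w\<close> into its own right-hand
    side.\<close>
  then have "v = v \<otimes> (w \<otimes> w)"
    using c by (metis m_assoc)
  then show False
    using c ww by simp
qed

text \<open>Facts about \<open>Min\<close> require a finite set; both bounds on the alliance number
  below rest on this.\<close>

lemma finite_alliance_cards:
  assumes "finite (pverts G)"
  shows "finite {card S | S. global_offensive_alliance G S}"
proof (rule finite_subset)
  show "{card S | S. global_offensive_alliance G S} \<subseteq> card ` Pow (pverts G)"
    by (auto simp: global_offensive_alliance_def)
qed (use assms in simp)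

lemma global_offensive_alliance_number_le:
  assumes "finite (pverts G)" and "global_offensive_alliance G S"
  shows "global_offensive_alliance_number G \<le> card S"
  unfolding global_offensive_alliance_number_def
  using assms by (intro Min_le finite_alliance_cards) auto

text \<open>The minimum is attained, since the whole vertex set is an alliance, and alliances are
  nonempty. This gives the lower bound in the sharpness example.\<close>

lemma global_offensive_alliance_number_pos:
  assumes fin: "finite (pverts G)" and "pverts G \<noteq> {}"
  shows "0 < global_offensive_alliance_number G"
proof -
  let ?A = "{card S | S. global_offensive_alliance G S}"
  have "global_offensive_alliance G (pverts G)"
    using assms by (simp add: global_offensive_alliance_def)
  then have "?A \<noteq> {}"
    by blast
  then have "global_offensive_alliance_number G \<in> ?A"
    unfolding global_offensive_alliance_number_def
    by (intro Min_in finite_alliance_cards fin)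
  then show ?thesis
    using fin by (auto simp: global_offensive_alliance_def card_gt_0_iff dest: finite_subset)
qed

lemma (in pair_graph) alliance_number_less_card_pverts:
  assumes "(v, w) \<in> parcs G"
  shows "global_offensive_alliance_number G < card (pverts G)"
proof -
  have v: "v \<in> pverts G" and w: "w \<in> pverts G"
    using assms by (auto dest: in_arcsD1 in_arcsD2)
  have "v \<noteq> w"
    using no_loops'[OF assms] by simp
  have "w \<in> neighbors G v \<inter> (pverts G - {v})"
    using assms w \<open>v \<noteq> w\<close> by (simp add: neighbors_def)
  then have "1 \<le> degree_in G (pverts G - {v}) v"
    unfolding degree_in_def
    by (metis One_nat_def Suc_leI card_gt_0_iff empty_iff finite_Diff finite_Int pair_finite_verts)
  \<comment> \<open>Only \<open>v\<close> lies outside the candidate alliance, and without loops it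
    has no neighbour there, so the one neighbour \<open>w\<close> inside suffices. The same
    \<open>w\<close> makes the alliance nonempty.\<close>
  moreover have "degree_in G {v} v = 0"
    by (auto simp: degree_in_def neighbors_def dest: no_loops')
  moreover have "pverts G - (pverts G - {v}) = {v}"
    using v by blast
  ultimately have "global_offensive_alliance G (pverts G - {v})"
    using w \<open>v \<noteq> w\<close> by (auto simp: global_offensive_alliance_def)
  then have "global_offensive_alliance_number G \<le> card (pverts G - {v})"
    by (rule global_offensive_alliance_number_le[OF pair_finite_verts])
  also have "\<dots> < card (pverts G)"
    using v by (intro card_Diff1_less pair_finite_verts)
  finally show ?thesis .
qed

lemma alliance_number_zero_divisor_graph_le:
  assumes "cring R" and one: "\<one>\<^bsub>R\<^esub> \<noteq> \<zero>\<^bsub>R\<^esub>" and fin: "finite (carrier R)" and "\<not> field R"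
    and "card (zero_divisors R) \<noteq> 2"
  shows "global_offensive_alliance_number (zero_divisor_graph R) + 2 \<le> card (zero_divisors R)"
proof -
  interpret cring R by fact
  interpret G: pair_graph "zero_divisor_graph R"
    by (rule pair_graph_zero_divisor_graph[OF assms(1) fin])
  have Z0: "\<zero>\<^bsub>R\<^esub> \<in> zero_divisors R"
    by (rule zero_in_zero_divisors[OF one])
  have finZ: "finite (zero_divisors R)"
    using fin by (simp add: zero_divisors_def)
  have cardZ: "card (zero_divisors R) = Suc (card (zero_divisors R - {\<zero>\<^bsub>R\<^esub>}))"
    using card.remove[OF finZ Z0] .
  obtain v where v: "v \<in> zero_divisors R - {\<zero>\<^bsub>R\<^esub>}"
    using finite_no_zero_divisors_field[OF fin one] assms(4) by blast
  \<comment> \<open>A one-vertex graph means exactly two zero-divisors, the case excluded by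
    hypothesis.\<close>
  moreover have "zero_divisors R - {\<zero>\<^bsub>R\<^esub>} \<noteq> {v}"
  proof
    assume "zero_divisors R - {\<zero>\<^bsub>R\<^esub>} = {v}"
    with cardZ have "card (zero_divisors R) = Suc (card {v})"
      by (simp only:)
    with assms(5) show False
      by simp
  qed
  ultimately obtain w where "w \<in> zero_divisors R - {\<zero>\<^bsub>R\<^esub>}" "v \<noteq> w"
    by blast
  with v obtain x y where "(x, y) \<in> parcs (zero_divisor_graph R)"
    by (rule zero_divisor_graph_has_arc)
  \<comment> \<open>The summand 2 is one for the removed vertex and one for \<open>\<zero>\<close>,
    which is a zero-divisor but not a vertex.\<close>
  from G.alliance_number_less_card_pverts[OF this] show ?thesis
    unfolding cardZ by simp
qed

lemma zero_divisors_residue_ring_9: "zero_divisors (residue_ring 9) = {0, 3, 6}"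
proof -
  have c: "carrier (residue_ring 9) = {0, 1, 2, 3, 4, 5, 6, 7, 8}"
    by (auto simp: residue_ring_def)
  show ?thesis
    unfolding zero_divisors_def c by (auto simp: residue_ring_def)
qed

text \<open>The vertices 3 and 6 are adjacent because 18 vanishes modulo 9, so the number is
  positive and less than 2.\<close>

lemma alliance_number_residue_ring_9:
  "global_offensive_alliance_number (zero_divisor_graph (residue_ring 9)) = 1"
proof -
  interpret residues 9 "residue_ring 9" by unfold_locales simp_all
  interpret G: pair_graph "zero_divisor_graph (residue_ring 9)"
    by (rule pair_graph_zero_divisor_graph[OF cring]) simp
  have V: "pverts (zero_divisor_graph (residue_ring 9)) = {3, 6}"
    by (auto simp: zero_divisors_residue_ring_9 res_zero_eq)
  have "(3, 6) \<in> parcs (zero_divisor_graph (residue_ring 9))"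
    by (simp add: zero_divisor_graph_def zero_divisors_residue_ring_9 res_zero_eq res_mult_eq)
  from G.alliance_number_less_card_pverts[OF this] show ?thesis
    using global_offensive_alliance_number_pos[of "zero_divisor_graph (residue_ring 9)"]
    unfolding V by simp
qed

theorem theorem2p1:
  shows "(\<forall>R :: ('a, 'm) ring_scheme.
            cring R \<and> \<one>\<^bsub>R\<^esub> \<noteq> \<zero>\<^bsub>R\<^esub> \<and> finite (carrier R) \<and> \<not> field R \<and>
            card (zero_divisors R) \<noteq> 2 \<longrightarrow>
            global_offensive_alliance_number (zero_divisor_graph R) + 2 \<le> card (zero_divisors R)) \<and>
         global_offensive_alliance_number (zero_divisor_graph (residue_ring 9)) + 2 =
           card (zero_divisors (residue_ring 9))"
  using alliance_number_zero_divisor_graph_le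
  by (auto simp: alliance_number_residue_ring_9 zero_divisors_residue_ring_9)

end
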